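(* Let $N_t,N_r,L\ge1$, $N_0>0$, let $\boldsymbol{\Sigma}_1,\dots,\boldsymbol{\Sigma}_L$ be $N_t\times N_t$ Hermitian positive definite matrices, let $l\in\{1,\dots,L\}$, let $\mathbf{F}_l\in\mathbb{C}^{N_t\times N_t}$, and let $\mathbf{H}_l$ be a random $N_r\times N_t$ complex matrix with $\mathbf{R}_{g,l}=E[\mathbf{H}_l^H\mathbf{H}_l]$ finite and positive definite. With $R_l$, $\mathbf{A}_l,\mathbf{B}_l,\mathbf{C}_l$ as in the context, and $\mathbf{D}_l=\mathbf{B}_l-\mathbf{A}_l^H\mathbf{C}_l^{-1}\mathbf{A}_l$, $$R_l\le R_{{\rm upp},l}=\log_2\det(\boldsymbol{\Sigma}_l)-\log_2\det(\mathbf{C}_l)-\Big[\log_2\det\Big(\mathbf{R}_{g,l}\Big(\mathbf{D}_l+\sum_{t=l+1}^L\boldsymbol{\Sigma}_t\Big)+N_0\mathbf{I}_{N_t}\Big)-\log_2\det\Big(\mathbf{R}_{g,l}\Big(\mathbf{B}_l+\sum_{t=l+1}^L\boldsymbol{\Sigma}_t\Big)+N_0\mathbf{I}_{N_t}\Big)\Big].$$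
   Context: Define $\boldsymbol{\Sigma}_{S,l}=\sum_{t=1}^{l-1}\boldsymbol{\Sigma}_t$ (zero for $l=1$), $\mathbf{A}_l=\mathbf{F}_l\boldsymbol{\Sigma}_{S,l}+\boldsymbol{\Sigma}_l$, $\mathbf{B}_l=\boldsymbol{\Sigma}_{S,l}+\boldsymbol{\Sigma}_l$, $\mathbf{C}_l=\mathbf{F}_l\boldsymbol{\Sigma}_{S,l}\mathbf{F}_l^H+\boldsymbol{\Sigma}_l$, $\boldsymbol{\Sigma}_{Z,l}(\mathbf{H}_l)=\mathbf{H}_l\big(\sum_{t=l+1}^L\boldsymbol{\Sigma}_t\big)\mathbf{H}_l^H+N_0\mathbf{I}_{N_r}$, $\boldsymbol{\Sigma}_{\mathbf{u}_l|\mathbf{y}_l,\mathbf{H}_l}(\mathbf{H}_l)=\mathbf{C}_l-\mathbf{A}_l\mathbf{H}_l^H\big[\mathbf{H}_l\mathbf{B}_l\mathbf{H}_l^H+\boldsymbol{\Sigma}_{Z,l}(\mathbf{H}_l)\big]^{-1}\mathbf{H}_l\mathbf{A}_l^H$, and the linear assignment achievable rate $R_l=\log_2\det(\boldsymbol{\Sigma}_l)-E\big[\log_2\det\boldsymbol{\Sigma}_{\mathbf{u}_l|\mathbf{y}_l,\mathbf{H}_l}(\mathbf{H}_l)\big]$. *)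

theory Defs
  imports "HOL-Analysis.Analysis" "HOL-Probability.Probability"
begin

definition mH :: "complex^'n^'m \<Rightarrow> complex^'m^'n" where
  "mH X = (\<chi> i j. cnj (X $ j $ i))"

definition hpd :: "complex^'n^'n \<Rightarrow> bool" where
  "hpd X \<longleftrightarrow> mH X = X \<and>
     (\<forall>x::complex^'n. x \<noteq> 0 \<longrightarrow> 0 < Re (\<Sum>i\<in>UNIV. cnj (x $ i) * ((X *v x) $ i)))"

(* log2 det of a matrix whose determinant is real and positive *)
definition logdet2 :: "complex^'n^'n \<Rightarrow> real" where
  "logdet2 X = log 2 (Re (det X))"

definition cI :: "complex^'n^'n" where "cI = mat 1"

definition msum :: "(nat \<Rightarrow> complex^'n^'n) \<Rightarrow> nat set \<Rightarrow> complex^'n^'n" where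
  "msum Sig T = (\<Sum>t\<in>T. Sig t)"

definition SigS :: "(nat \<Rightarrow> complex^'n^'n) \<Rightarrow> nat \<Rightarrow> complex^'n^'n" where
  "SigS Sig l = msum Sig {1..<l}"

definition Amat where "Amat Sig F l = F ** SigS Sig l + Sig l"
definition Bmat where "Bmat Sig l = SigS Sig l + Sig l"
definition Cmat where "Cmat Sig F l = F ** SigS Sig l ** mH F + Sig l"
definition Dmat where
  "Dmat Sig F l = Bmat Sig l - mH (Amat Sig F l) ** matrix_inv (Cmat Sig F l) ** Amat Sig F l"

definition SigZ :: "(nat \<Rightarrow> complex^'nt^'nt) \<Rightarrow> nat \<Rightarrow> nat \<Rightarrow> real \<Rightarrow> complex^'nt^'nr \<Rightarrow> complex^'nr^'nr" where
  "SigZ Sig L l N0 H = H ** msum Sig {l+1..L} ** mH H + N0 *\<^sub>R cI"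

definition SigU :: "(nat \<Rightarrow> complex^'nt^'nt) \<Rightarrow> complex^'nt^'nt \<Rightarrow> nat \<Rightarrow> nat \<Rightarrow> real
                      \<Rightarrow> complex^'nt^'nr \<Rightarrow> complex^'nt^'nt" where
  "SigU Sig F L l N0 H = Cmat Sig F l - Amat Sig F l ** mH H **
      matrix_inv (H ** Bmat Sig l ** mH H + SigZ Sig L l N0 H) ** H ** mH (Amat Sig F l)"

definition eexp :: "'w measure \<Rightarrow> ('w \<Rightarrow> real) \<Rightarrow> ereal" where
  "eexp M f = enn2ereal (\<integral>\<^sup>+ w. ennreal (f w) \<partial>M) - enn2ereal (\<integral>\<^sup>+ w. ennreal (- f w) \<partial>M)"

definition Rrate where
  "Rrate M Sig F L l N0 H = ereal (logdet2 (Sig l)) - eexp M (\<lambda>w. logdet2 (SigU Sig F L l N0 (H w)))"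

definition Rg :: "'w measure \<Rightarrow> ('w \<Rightarrow> complex^'nt^'nr) \<Rightarrow> complex^'nt^'nt" where
  "Rg M H = (\<chi> i j. \<integral>w. (mH (H w) ** H w) $ i $ j \<partial>M)"

definition Rupp where
  "Rupp M Sig F L l N0 H = logdet2 (Sig l) - logdet2 (Cmat Sig F l)
     - (logdet2 (Rg M H ** (Dmat Sig F l + msum Sig {l+1..L}) + N0 *\<^sub>R cI)
        - logdet2 (Rg M H ** (Bmat Sig l + msum Sig {l+1..L}) + N0 *\<^sub>R cI))"

end

theory Submission
  imports Defs "HOL-Computational_Algebra.Polynomial" "HOL-Library.Complex_Order"
begin

text \<open>
  Write \<open>c = N\<^sub>0\<close>, \<open>G = H\<^sup>H H\<close> and \<open>P = D + (\<Sum>t>l. \<Sigma>\<^sub>t)\<close>. By the Woodbury identity the inverse of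
  the conditional covariance is \<open>K(G) = C\<^sup>-\<^sup>1 + C\<^sup>-\<^sup>1 A N(G) A\<^sup>H C\<^sup>-\<^sup>1\<close> with
  \<open>N(G) = (G P + c)\<^sup>-\<^sup>1 G\<close>. The map \<open>N\<close> is operator concave and \<open>ln det\<close> is concave and monotone, so
  \<open>G \<mapsto> ln det K(G)\<close> is concave on positive semidefinite matrices, and the theorem is Jensen's
  inequality at \<open>E[G]\<close>, where Sylvester's determinant identity evaluates \<open>ln det K\<close>. The concavity
  of \<open>ln det\<close> comes from \<open>ln det X \<le> tr X - n\<close>, that is, from Hadamard's inequality
  \<open>det X \<le> (\<Prod>i. X\<^sub>i\<^sub>i)\<close> and \<open>ln x \<le> x - 1\<close>. No inverse of \<open>P\<close> or \<open>G\<close> is needed: either may be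
  singular (\<open>P = 0\<close> for \<open>l = L = 1\<close>).
\<close>

section \<open>Matrix algebra\<close>

lemma matrix_add_rdistrib: "((A :: 'a::semiring_1^'n^'m) + B) ** C = A ** C + B ** C"
  by (vector matrix_matrix_mult_def sum.distrib[symmetric] distrib_right)

lemma matrix_diff_ldistrib: "(A :: 'a::ring_1^'n^'m) ** (B - C) = A ** B - A ** C"
  by (vector matrix_matrix_mult_def sum_subtractf[symmetric] right_diff_distrib)

lemma matrix_diff_rdistrib: "((A :: 'a::ring_1^'n^'m) - B) ** C = A ** C - B ** C"
  by (vector matrix_matrix_mult_def sum_subtractf[symmetric] left_diff_distrib)

lemmas matrix_ring_simps = matrix_add_ldistrib matrix_add_rdistrib matrix_diff_ldistrib
  matrix_diff_rdistrib scalar_matrix_assoc[symmetric] matrix_scalar_ac matrix_mul_assoc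

lemma mat_mult_commute:
  fixes X :: "'a::comm_semiring_1^'n^'n"
  shows "mat a ** X = X ** mat a"
  by (simp add: matrix_matrix_mult_def mat_def vec_eq_iff if_distrib if_distribR mult.commute
      cong: if_cong)

lemma scaleR_mat_one: "c *\<^sub>R mat 1 = (mat (of_real c) :: complex^'n^'n)"
  by (simp add: mat_def vec_eq_iff scaleR_conv_of_real[where 'a = complex])

lemma matrix_inv_cancel:
  fixes X :: "'a::semiring_1^'n^'m"
  assumes "invertible X"
  shows "X ** matrix_inv X = mat 1" and "matrix_inv X ** X = mat 1"
  using someI_ex[OF assms[unfolded invertible_def]] by (simp_all add: matrix_inv_def)

lemma matrix_inv_unique:
  fixes X :: "'a::field^'n^'n"
  assumes "X ** Y = mat 1"
  shows "matrix_inv X = Y"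
proof -
  have "invertible X" using assms by (auto simp: invertible_right_inverse)
  then have "matrix_inv X ** (X ** Y) = Y" by (simp add: matrix_mul_assoc matrix_inv_cancel)
  then show ?thesis using assms by simp
qed

lemma matrix_inv_push_through:
  fixes A :: "'a::semiring_1^'n^'m"
  assumes "invertible X" and "invertible Y" and "X ** A = A ** Y"
  shows "matrix_inv X ** A = A ** matrix_inv Y"
proof -
  have "matrix_inv X ** A = matrix_inv X ** (A ** Y) ** matrix_inv Y"
    using assms(2) by (simp add: matrix_inv_cancel flip: matrix_mul_assoc)
  also have "\<dots> = A ** matrix_inv Y"
    using assms(1) by (simp add: matrix_mul_assoc matrix_inv_cancel flip: assms(3))
  finally show ?thesis .
qed

lemma matrix_inv_woodbury:
  fixes C :: "'a::field^'n^'n" and U :: "'a^'m^'n" and V :: "'a^'n^'m"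
  assumes "invertible C" and "invertible K" and "invertible (K - V ** matrix_inv C ** U)"
  shows "matrix_inv (matrix_inv C
      + matrix_inv C ** U ** matrix_inv (K - V ** matrix_inv C ** U) ** V ** matrix_inv C)
    = C - U ** matrix_inv K ** V"
proof (rule matrix_inv_unique)
  let ?Ci = "matrix_inv C" and ?Ki = "matrix_inv K"
  define S where "S = K - V ** ?Ci ** U"
  let ?L = "?Ci ** U ** matrix_inv S"
  have "(?Ci + ?L ** V ** ?Ci) ** (C - U ** ?Ki ** V)
      = ?Ci ** C + ?L ** V ** (?Ci ** C) - ?Ci ** U ** ?Ki ** V - ?L ** (V ** ?Ci ** U) ** ?Ki ** V"
    by (simp add: matrix_ring_simps)
  also have "V ** ?Ci ** U = K - S" by (simp add: S_def)
  also have "?L ** (K - S) ** ?Ki ** V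
      = ?L ** (K ** ?Ki) ** V - ?Ci ** U ** (matrix_inv S ** S) ** ?Ki ** V"
    by (simp add: matrix_ring_simps)
  finally show "(?Ci + ?Ci ** U ** matrix_inv (K - V ** ?Ci ** U) ** V ** ?Ci)
      ** (C - U ** ?Ki ** V) = mat 1"
    using assms by (simp add: matrix_inv_cancel flip: S_def)
qed

lemma poly_det: "poly (det A) s = det (\<chi> i j. poly (A $ i $ j) s)"
  by (simp add: det_def poly_sum poly_prod)

lemma det_mat_add_mult_commute:
  fixes X Y :: "'a::idom^'n^'n"
  shows "det (mat a + X ** Y) = det (mat a + Y ** X)"
proof -
  \<comment> \<open>Over the polynomial ring \<open>(1 - t) X + t\<close> has nonzero determinant, which can be cancelled;
    then set \<open>t = 0\<close>.\<close>
  define X' :: "'a poly^'n^'n" where "X' = (\<chi> i j. [:X $ i $ j, mat 1 $ i $ j - X $ i $ j:])"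
  define Y' :: "'a poly^'n^'n" where "Y' = (\<chi> i j. [:Y $ i $ j:])"
  have "poly (det X') 1 = det (mat 1 :: 'a^'n^'n)"
    unfolding poly_det by (rule arg_cong[where f = det]) (simp add: X'_def vec_eq_iff)
  then have "det X' \<noteq> 0" by auto
  moreover have "(mat [:a:] + X' ** Y') ** X' = X' ** (mat [:a:] + Y' ** X')"
    by (simp add: matrix_ring_simps mat_mult_commute)
  ultimately have "det (mat [:a:] + X' ** Y') = det (mat [:a:] + Y' ** X')"
    by (metis det_mul mult.commute mult_cancel_left)
  moreover have "poly (det (mat [:a:] + X' ** Y')) 0 = det (mat a + X ** Y)"
    "poly (det (mat [:a:] + Y' ** X')) 0 = det (mat a + Y ** X)"
    unfolding poly_det
    by (rule arg_cong[where f = det],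
        simp add: X'_def Y'_def vec_eq_iff matrix_matrix_mult_def poly_sum mat_def mult.commute)+
  ultimately show ?thesis by simp
qed

section \<open>Positive semidefinite matrices\<close>

lemma mH_mH [simp]: "mH (mH X) = X"
  and mH_add: "mH (X + Y) = mH X + mH Y"
  and mH_diff: "mH (X - Y) = mH X - mH Y"
  and mH_scaleR: "mH (c *\<^sub>R X) = c *\<^sub>R mH X"
  by (simp_all add: mH_def vec_eq_iff)

lemma mH_mat_one [simp]: "mH (mat 1) = mat 1"
  by (simp add: mH_def mat_def vec_eq_iff)

lemma mH_mult: "mH (X ** Y) = mH Y ** mH X"
  by (simp add: mH_def matrix_matrix_mult_def vec_eq_iff mult.commute)

lemma det_mH: "det (mH X) = cnj (det X)"
proof -
  have "mH X = transpose (\<chi> i j. cnj (X $ i $ j))" by (simp add: mH_def transpose_def)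
  then show ?thesis by (simp add: det_def[of "vec_lambda _"] det_def[of X])
qed

lemma mH_matrix_inv:
  fixes X :: "complex^'n^'n"
  assumes "invertible X"
  shows "mH (matrix_inv X) = matrix_inv (mH X)"
  using assms by (intro matrix_inv_unique[symmetric]) (simp add: matrix_inv_cancel flip: mH_mult)

definition cinner :: "complex^'n \<Rightarrow> complex^'n \<Rightarrow> complex" where
  "cinner x y = (\<Sum>i\<in>UNIV. cnj (x $ i) * y $ i)"

lemma cinner_add_left: "cinner (x + y) z = cinner x z + cinner y z"
  and cinner_add_right: "cinner x (y + z) = cinner x y + cinner x z"
  and cinner_scale_left: "cinner (a *s x) y = cnj a * cinner x y"
  and cinner_scale_right: "cinner x (a *s y) = a * cinner x y"
  by (simp_all add: cinner_def sum.distrib algebra_simps sum_distrib_left)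

lemma cinner_zero_right [simp]: "cinner x 0 = 0"
  by (simp add: cinner_def)

lemma cinner_axis: "cinner (axis k 1) y = y $ k"
  by (simp add: cinner_def axis_def if_distrib if_distribR cong: if_cong)

lemma matrix_vector_mult_axis: "((X :: 'a::semiring_1^'n^'m) *v axis k 1) $ i = X $ i $ k"
  by (simp add: matrix_vector_mult_def axis_def if_distrib[of "(*) _"] cong: if_cong)

lemma cinner_self: "cinner x x = of_real ((norm x)\<^sup>2)"
  by (simp add: cinner_def norm_vec_def L2_set_def sum_nonneg complex_norm_square mult.commute
      del: of_real_power)

lemma cinner_matrix_vector_mult: "cinner x (X *v y) = cinner (mH X *v x) y"
  by (simp add: cinner_def matrix_vector_mult_def mH_def sum_distrib_left sum_distrib_right)
    (subst sum.swap, simp add: mult_ac)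

definition psd :: "complex^'n^'n \<Rightarrow> bool" where
  "psd X \<longleftrightarrow> mH X = X \<and> (\<forall>x. 0 \<le> Re (cinner x (X *v x)))"

lemma psdD: "psd X \<Longrightarrow> mH X = X" "psd X \<Longrightarrow> 0 \<le> Re (cinner x (X *v x))"
  by (simp_all add: psd_def)

lemma hpd_iff: "hpd X \<longleftrightarrow> mH X = X \<and> (\<forall>x. x \<noteq> 0 \<longrightarrow> 0 < Re (cinner x (X *v x)))"
  by (simp add: hpd_def cinner_def)

lemma hpdD: "hpd X \<Longrightarrow> mH X = X" "hpd X \<Longrightarrow> x \<noteq> 0 \<Longrightarrow> 0 < Re (cinner x (X *v x))"
  by (simp_all add: hpd_iff)

lemma hpd_imp_psd:
  assumes "hpd X"
  shows "psd X"
  unfolding psd_def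
proof (intro conjI allI)
  show "0 \<le> Re (cinner x (X *v x))" for x
    using hpdD(2)[OF assms, of x] by (cases "x = 0") auto
qed (rule hpdD(1)[OF assms])

lemma psd_add: "psd X \<Longrightarrow> psd Y \<Longrightarrow> psd (X + Y)"
  by (simp add: psd_def mH_add matrix_vector_mult_add_rdistrib cinner_add_right)

lemma hpd_add_psd: "hpd X \<Longrightarrow> psd Y \<Longrightarrow> hpd (X + Y)"
  by (simp add: psd_def hpd_iff mH_add matrix_vector_mult_add_rdistrib cinner_add_right
      add_pos_nonneg)

lemma psd_zero: "psd 0"
  by (simp add: psd_def mH_def vec_eq_iff)

lemma psd_sum: "(\<And>t. t \<in> I \<Longrightarrow> psd (f t)) \<Longrightarrow> psd (sum f I)"
  by (induction I rule: infinite_finite_induct) (auto intro: psd_add simp: psd_zero)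

lemma scaleR_matrix_vector_mult:
  fixes X :: "complex^'n^'m"
  shows "(c *\<^sub>R X) *v x = of_real c *s (X *v x)"
  by (simp add: vec_eq_iff matrix_vector_mult_def sum_distrib_left
      scaleR_conv_of_real[where 'a = complex] mult.assoc)

lemma psd_scaleR: "0 \<le> c \<Longrightarrow> psd X \<Longrightarrow> psd (c *\<^sub>R X)"
  by (simp add: psd_def mH_scaleR cinner_scale_right scaleR_matrix_vector_mult)

lemma hpd_scaleR_mat_one: "0 < c \<Longrightarrow> hpd (c *\<^sub>R mat 1)"
  by (simp add: hpd_iff mH_scaleR cinner_scale_right scaleR_matrix_vector_mult cinner_self)

lemma psd_congruence:
  fixes X :: "complex^'n^'n" and T :: "complex^'n^'m"
  assumes "psd X"
  shows "psd (T ** X ** mH T)"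
  unfolding psd_def
proof (intro conjI allI)
  show "mH (T ** X ** mH T) = T ** X ** mH T"
    using assms by (simp add: mH_mult psdD matrix_mul_assoc)
  fix x
  have "cinner x ((T ** X ** mH T) *v x) = cinner (mH T *v x) (X *v (mH T *v x))"
    by (simp only: cinner_matrix_vector_mult[of x T, symmetric] matrix_vector_mul_assoc
        matrix_mul_assoc)
  then show "0 \<le> Re (cinner x ((T ** X ** mH T) *v x))"
    using assms by (simp add: psdD)
qed

lemma psd_gram: "psd (mH T ** T)"
  using psd_congruence[OF hpd_imp_psd[OF hpd_scaleR_mat_one[of 1]], of "mH T"] by simp

lemma psd_quadratic_form_eq_0:
  assumes X: "psd X" and isotropic: "Re (cinner x (X *v x)) = 0"
  shows "X *v x = 0"
proof (rule ccontr)
  define y where "y = X *v x"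
  define a b where "a = (norm y)\<^sup>2" and "b = Re (cinner y (X *v y))"
  assume "X *v x \<noteq> 0"
  then have a_pos: "a > 0" by (simp add: a_def y_def)
  have b_nonneg: "b \<ge> 0" using X by (simp add: b_def psdD)
  have x_Xy: "cinner x (X *v y) = of_real a"
    using X by (simp add: cinner_matrix_vector_mult psdD cinner_self a_def flip: y_def)
  have quadratic: "0 \<le> t\<^sup>2 * b + 2 * t * a" for t :: real
  proof -
    have "0 \<le> Re (cinner (x + of_real t *s y) (X *v (x + of_real t *s y)))" using X by (rule psdD)
    also have "\<dots> = t\<^sup>2 * b + 2 * t * a"
      using isotropic x_Xy cinner_self[of y]
      by (simp add: vector_scalar_commute cinner_add_left cinner_add_right cinner_scale_left
          cinner_scale_right a_def b_def power2_eq_square algebra_simps flip: y_def)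
    finally show ?thesis .
  qed
  from quadratic[of "- a / (b + 1)"] have "0 \<le> (a / (b + 1))\<^sup>2 * b - 2 * (a / (b + 1)) * a" by simp
  also have "\<dots> = (a / (b + 1))\<^sup>2 * (b - 2 * (b + 1))"
    using b_nonneg by (simp add: power2_eq_square divide_simps) (simp add: algebra_simps)
  also have "\<dots> < 0" using a_pos b_nonneg by (intro mult_pos_neg) auto
  finally show False by simp
qed

lemma hpd_iff_psd_invertible: "hpd X \<longleftrightarrow> psd X \<and> invertible X"
proof (intro iffI conjI)
  assume X: "hpd X"
  then show "psd X" by (rule hpd_imp_psd)
  have "x = 0" if "X *v x = 0" for x
    using hpdD(2)[OF X, of x] that by fastforce
  then show "invertible X"
    by (simp add: invertible_left_inverse matrix_left_invertible_ker)
next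
  assume X: "psd X \<and> invertible X"
  have "0 < Re (cinner x (X *v x))" if "x \<noteq> 0" for x
  proof -
    have "X *v x \<noteq> 0"
      using X that by (auto simp: invertible_left_inverse matrix_left_invertible_ker)
    then show ?thesis
      using X psdD(2)[of X x] psd_quadratic_form_eq_0[of X x] by fastforce
  qed
  then show "hpd X" using X by (simp add: hpd_iff psdD)
qed

lemma hpd_imp_invertible: "hpd X \<Longrightarrow> invertible X"
  by (simp add: hpd_iff_psd_invertible)

lemma invertible_mH: "invertible X \<Longrightarrow> invertible (mH X)"
  by (metis invertible_def mH_mult mH_mat_one)

lemma hpd_congruence:
  fixes X T :: "complex^'n^'n"
  assumes "hpd X" and "invertible T"
  shows "hpd (T ** X ** mH T)"
  using assms by (simp add: hpd_iff_psd_invertible psd_congruence invertible_mult invertible_mH)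

lemma hpd_matrix_inv:
  assumes "hpd X"
  shows "hpd (matrix_inv X)"
proof -
  note X = hpd_imp_invertible[OF assms]
  have "invertible (matrix_inv X)" using matrix_inv_cancel[OF X] by (auto simp: invertible_def)
  from hpd_congruence[OF assms this] show ?thesis
    using X hpdD(1)[OF assms] by (simp add: matrix_inv_cancel mH_matrix_inv)
qed

lemma psd_diag_nonneg:
  assumes "psd X"
  shows "0 \<le> X $ k $ k"
proof -
  have "mH X $ k $ k = X $ k $ k" using assms by (simp add: psdD)
  then have "Im (X $ k $ k) = 0" by (simp add: mH_def complex_eq_iff)
  moreover have "0 \<le> Re (X $ k $ k)"
    using psdD(2)[OF assms, of "axis k 1"] by (simp add: cinner_axis matrix_vector_mult_axis)
  ultimately show ?thesis by (simp add: less_eq_complex_def)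
qed

lemma psd_diag_eq_0:
  assumes "psd X" and "X $ k $ k = 0"
  shows "X $ i $ k = 0"
proof -
  have "X *v axis k 1 = 0"
    using assms
    by (intro psd_quadratic_form_eq_0) (simp_all add: cinner_axis matrix_vector_mult_axis)
  then show ?thesis by (simp add: vec_eq_iff matrix_vector_mult_axis)
qed

section \<open>Congruence to a diagonal matrix\<close>

definition decoupled :: "complex^'n^'n \<Rightarrow> 'n \<Rightarrow> bool" where
  "decoupled X i \<longleftrightarrow> (\<forall>j. j \<noteq> i \<longrightarrow> X $ i $ j = 0)"

lemma psd_pivot_elimination:
  fixes X :: "complex^'n^'n"
  assumes X: "psd X"
  obtains T where "det T = 1" and "decoupled (T ** X ** mH T) k"
    and "(T ** X ** mH T) $ k $ k = X $ k $ k"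
    and "\<And>i j. i \<noteq> k \<Longrightarrow>
      (T ** X ** mH T) $ i $ j = X $ i $ j - X $ i $ k / X $ k $ k * X $ k $ j"
proof
  \<comment> \<open>If the pivot \<open>X $ k $ k\<close> is \<open>0\<close>, then so are its row and column and, since \<open>x / 0 = 0\<close>, \<open>V\<close>.\<close>
  define V :: "complex^'n^'n"
    where "V = (\<chi> i j. if j = k \<and> i \<noteq> k then - (X $ i $ k / X $ k $ k) else 0)"
  define E :: "complex^'n^'n" where "E = (\<chi> i j. if i = k \<and> j = k then 1 else 0)"
  define T W Y where "T = mat 1 + V" and "W = T ** X" and "Y = T ** X ** mH T"
  have V_other: "V $ i $ j = 0" if "j \<noteq> k" for i j using that by (simp add: V_def)
  have V_mult: "(V ** Z) $ i $ j = V $ i $ k * Z $ k $ j" for Z :: "complex^'n^'n" and i j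
    by (simp add: matrix_matrix_mult_def V_other sum.remove[of UNIV k])
  have mult_mH_V: "(Z ** mH V) $ i $ j = Z $ i $ k * cnj (V $ j $ k)"
    for Z :: "complex^'n^'n" and i j
    by (simp add: matrix_matrix_mult_def mH_def V_other sum.remove[of UNIV k])
  have "V ** E = V" by (simp add: vec_eq_iff V_mult) (simp add: E_def V_def)
  moreover have "E ** V = 0"
    by (auto simp: vec_eq_iff matrix_matrix_mult_def V_def E_def intro!: sum.neutral)
  ultimately show "det T = 1"
    using det_mat_add_mult_commute[of 1 V E] by (simp add: T_def)
  have W: "W $ i $ j = X $ i $ j + V $ i $ k * X $ k $ j" for i j
    by (simp add: W_def T_def matrix_add_rdistrib V_mult)
  have W_col: "W $ i $ k = 0" if "i \<noteq> k" for i
    using that psd_diag_eq_0[OF X, of k i] by (simp add: W V_def)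
  have Y: "Y $ i $ j = W $ i $ j + W $ i $ k * cnj (V $ j $ k)" for i j
    by (simp add: Y_def T_def mH_add matrix_add_ldistrib mult_mH_V W_def)
  show "(T ** X ** mH T) $ i $ j = X $ i $ j - X $ i $ k / X $ k $ k * X $ k $ j" if "i \<noteq> k" for i j
    using that W_col[OF that] unfolding Y_def[symmetric] Y by (simp add: W V_def)
  show "(T ** X ** mH T) $ k $ k = X $ k $ k"
    unfolding Y_def[symmetric] by (simp add: Y W V_def)
  have "mH Y $ k $ j = 0" if "j \<noteq> k" for j
    by (simp add: mH_def Y W_col[OF that])
  then show "decoupled (T ** X ** mH T) k"
    using psdD(1)[OF psd_congruence[OF X, of T]] by (simp add: decoupled_def Y_def)
qed

lemma psd_pivot_update_nonneg:
  assumes "psd X"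
  shows "0 \<le> Re (X $ i $ k / X $ k $ k * X $ k $ i)"
proof -
  have "X $ k $ i = mH X $ k $ i" using assms by (simp add: psdD)
  then have "X $ k $ i = cnj (X $ i $ k)" by (simp add: mH_def)
  then have "X $ i $ k / X $ k $ k * X $ k $ i = (cmod (X $ i $ k))\<^sup>2 / X $ k $ k"
    by (simp add: complex_norm_square del: of_real_power)
  also have "\<dots> = of_real ((cmod (X $ i $ k))\<^sup>2 / Re (X $ k $ k))"
    using psd_diag_nonneg[OF assms, of k] by (simp add: nonnegative_complex_is_real)
  finally show ?thesis
    using psd_diag_nonneg[OF assms, of k] by (simp add: less_eq_complex_def)
qed

lemma psd_congruent_diagonal:
  fixes X :: "complex^'n^'n"
  assumes "psd X"
  obtains T where "det T = 1" and "\<And>i. decoupled (T ** X ** mH T) i"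
    and "\<And>i. Re ((T ** X ** mH T) $ i $ i) \<le> Re (X $ i $ i)"
proof -
  have "\<exists>T. det T = 1 \<and> (\<forall>i. decoupled (T ** X ** mH T) i)
      \<and> (\<forall>i. Re ((T ** X ** mH T) $ i $ i) \<le> Re (X $ i $ i))"
    if "finite K" "\<And>i. i \<notin> K \<Longrightarrow> decoupled X i" "psd X" for K and X :: "complex^'n^'n"
    using that
  proof (induction K arbitrary: X rule: finite_induct)
    case empty
    then show ?case by (intro exI[of _ "mat 1"]) simp
  next
    case (insert k K)
    obtain T where T: "det T = 1" "decoupled (T ** X ** mH T) k"
      "(T ** X ** mH T) $ k $ k = X $ k $ k"
      "\<And>i j. i \<noteq> k \<Longrightarrow> (T ** X ** mH T) $ i $ j = X $ i $ j - X $ i $ k / X $ k $ k * X $ k $ j"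
      by (rule psd_pivot_elimination[OF insert.prems(2), of k]) (rule that)
    have diag: "Re ((T ** X ** mH T) $ i $ i) \<le> Re (X $ i $ i)" for i
      using T(3,4) psd_pivot_update_nonneg[OF insert.prems(2), of i k] by (cases "i = k") simp_all
    have "decoupled (T ** X ** mH T) i" if "i \<notin> K" for i
    proof (cases "i = k")
      case False
      then have "decoupled X i" using insert.prems(1) that by simp
      with False show ?thesis by (simp add: decoupled_def T(4))
    qed (simp add: T(2))
    from insert.IH[OF this psd_congruence[OF insert.prems(2)]] obtain T' where
      "det T' = 1" "\<And>i. decoupled (T' ** (T ** X ** mH T) ** mH T') i"
      "\<And>i. Re ((T' ** (T ** X ** mH T) ** mH T') $ i $ i) \<le> Re ((T ** X ** mH T) $ i $ i)"
      by blast
    with T(1) diag show ?case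
      by (intro exI[of _ "T' ** T"])
        (auto simp: det_mul mH_mult matrix_mul_assoc intro: order.trans)
  qed
  from this[of UNIV] that assms show ?thesis by auto
qed

lemma psd_det_le_prod_diag:
  fixes X :: "complex^'n^'n"
  assumes "psd X"
  shows "Re (det X) \<le> (\<Prod>i\<in>UNIV. Re (X $ i $ i))"
proof -
  obtain T where T: "det T = 1" "\<And>i. decoupled (T ** X ** mH T) i"
    "\<And>i. Re ((T ** X ** mH T) $ i $ i) \<le> Re (X $ i $ i)"
    using psd_congruent_diagonal[OF assms] by blast
  let ?d = "\<lambda>i. Re ((T ** X ** mH T) $ i $ i)"
  have diag_nonneg: "0 \<le> (T ** X ** mH T) $ i $ i" for i
    by (intro psd_diag_nonneg psd_congruence assms)
  have "det X = det (T ** X ** mH T)" using T(1) by (simp add: det_mul det_mH)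
  also have "\<dots> = (\<Prod>i\<in>UNIV. (T ** X ** mH T) $ i $ i)"
    using T(2) by (intro det_diagonal) (auto simp: decoupled_def)
  also have "\<dots> = of_real (\<Prod>i\<in>UNIV. ?d i)"
    unfolding of_real_prod using diag_nonneg by (simp add: nonnegative_complex_is_real)
  finally have "Re (det X) = (\<Prod>i\<in>UNIV. ?d i)" by (metis Re_complex_of_real)
  also have "\<dots> \<le> (\<Prod>i\<in>UNIV. Re (X $ i $ i))"
    using diag_nonneg T(3) by (intro prod_mono) (simp add: less_eq_complex_def)
  finally show ?thesis .
qed

lemma psd_factorization:
  fixes X :: "complex^'n^'n"
  assumes "psd X"
  obtains R :: "complex^'n^'n" where "X = R ** mH R"
proof -
  obtain T where T: "det T = 1" "\<And>i. decoupled (T ** X ** mH T) i"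
    by (rule psd_congruent_diagonal[OF assms]) (rule that)
  define D where "D = T ** X ** mH T"
  define S :: "complex^'n^'n"
    where "S = (\<chi> i j. if i = j then of_real (sqrt (Re (D $ i $ i))) else 0)"
  have diag_nonneg: "0 \<le> D $ i $ i" for i
    unfolding D_def by (intro psd_diag_nonneg psd_congruence assms)
  have S: "(S ** mH S) $ i $ j = S $ i $ i * cnj (S $ j $ i)" for i j
    by (simp add: matrix_matrix_mult_def mH_def S_def sum.remove[of UNIV i])
  have "D $ i $ j = (S ** mH S) $ i $ j" for i j
  proof (cases "i = j")
    case True
    have "S $ i $ i * cnj (S $ i $ i) = of_real (Re (D $ i $ i))"
      using diag_nonneg[of i] by (simp add: S_def less_eq_complex_def flip: of_real_mult)
    with True show ?thesis using diag_nonneg[of i] by (simp add: S nonnegative_complex_is_real)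
  next
    case False
    then have "S $ j $ i = 0" by (simp add: S_def)
    with False T(2)[of i] show ?thesis by (simp add: S decoupled_def flip: D_def)
  qed
  then have D: "D = S ** mH S" by (simp add: vec_eq_iff)
  have T_inv: "invertible T" using T(1) by (simp add: invertible_det_nz)
  have "X = (matrix_inv T ** T) ** X ** mH (matrix_inv T ** T)"
    by (simp add: matrix_inv_cancel[OF T_inv])
  also have "\<dots> = matrix_inv T ** D ** mH (matrix_inv T)"
    by (simp add: D_def mH_mult matrix_mul_assoc)
  finally show ?thesis
    using that[of "matrix_inv T ** S"] by (simp add: D mH_mult matrix_mul_assoc)
qed

lemma psd_det_nonneg:
  fixes X :: "complex^'n^'n"
  assumes "psd X"
  shows "0 \<le> det X"
proof -
  obtain R :: "complex^'n^'n" where "X = R ** mH R" using assms by (rule psd_factorization)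
  then have "det X = of_real ((cmod (det R))\<^sup>2)"
    unfolding complex_norm_square by (simp add: det_mul det_mH)
  then show ?thesis by (simp add: less_eq_complex_def)
qed

lemma trace_psd_mult_nonneg:
  fixes X Y :: "complex^'n^'n"
  assumes "psd X" and "psd Y"
  shows "0 \<le> Re (trace (X ** Y))"
proof -
  obtain R :: "complex^'n^'n" where R: "X = R ** mH R" using assms(1) by (rule psd_factorization)
  have "trace (X ** Y) = trace (mH R ** Y ** R)"
    using trace_mul_sym[of R "mH R ** Y"] by (simp add: R matrix_mul_assoc)
  moreover have "psd (mH R ** Y ** R)" using psd_congruence[OF assms(2), of "mH R"] by simp
  ultimately show ?thesis
    by (auto simp: trace_def less_eq_complex_def intro!: sum_nonneg dest: psd_diag_nonneg)
qed

section \<open>The logarithm of the determinant\<close>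

definition ln_det :: "complex^'n^'n \<Rightarrow> real" where
  "ln_det X = ln (Re (det X))"

lemma logdet2_eq_ln_det: "logdet2 X = ln_det X / ln 2"
  by (simp add: logdet2_def ln_det_def log_def)

lemma hpd_det_pos:
  assumes "hpd X"
  shows "0 < det X"
  using assms psd_det_nonneg[of X]
  by (auto simp: hpd_iff_psd_invertible invertible_det_nz order_le_less)

lemma ln_det_mult:
  assumes "0 < det X" and "0 < det Y"
  shows "ln_det (X ** Y) = ln_det X + ln_det Y"
  using assms by (simp add: ln_det_def det_mul less_complex_def ln_mult)

lemma ln_det_matrix_inv:
  assumes "hpd X"
  shows "ln_det (matrix_inv X) = - ln_det X"
proof -
  have "ln_det X + ln_det (matrix_inv X) = ln_det (X ** matrix_inv X)"
    using assms by (intro ln_det_mult[symmetric] hpd_det_pos hpd_matrix_inv)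
  then show ?thesis
    using assms by (simp add: matrix_inv_cancel hpd_imp_invertible ln_det_def)
qed

lemma ln_det_le_trace:
  fixes X :: "complex^'n^'n"
  assumes "hpd X"
  shows "ln_det X \<le> Re (trace X) - CARD('n)"
proof -
  have pos: "0 < Re (X $ i $ i)" for i
    using hpdD(2)[OF assms, of "axis i 1"] by (simp add: cinner_axis matrix_vector_mult_axis)
  have "ln_det X \<le> ln (\<Prod>i\<in>UNIV. Re (X $ i $ i))"
    unfolding ln_det_def
    using hpd_det_pos[OF assms] psd_det_le_prod_diag[OF hpd_imp_psd[OF assms]]
    by (simp add: less_complex_def)
  also have "\<dots> = (\<Sum>i\<in>UNIV. ln (Re (X $ i $ i)))"
    using pos by (intro ln_prod) (simp_all add: less_imp_neq[symmetric])
  also have "\<dots> \<le> (\<Sum>i\<in>UNIV. Re (X $ i $ i) - 1)"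
    using pos by (intro sum_mono ln_le_minus_one)
  finally show ?thesis by (simp add: trace_def sum_subtractf)
qed

lemma ln_det_le_tangent:
  fixes X Y :: "complex^'n^'n"
  assumes X: "hpd X" and Y: "hpd Y"
  shows "ln_det X \<le> ln_det Y + Re (trace (matrix_inv Y ** (X - Y)))"
proof -
  note Yi = hpd_matrix_inv[OF Y]
  obtain R :: "complex^'n^'n" where R: "matrix_inv Y = R ** mH R"
    using hpd_imp_psd[OF Yi] by (rule psd_factorization)
  let ?Z = "mH R ** X ** R"
  have "det R \<noteq> 0" using hpd_det_pos[OF Yi] by (auto simp: R det_mul)
  then have Z: "hpd ?Z"
    using hpd_congruence[OF X invertible_mH, of R] by (simp add: invertible_det_nz)
  have "det ?Z = det (matrix_inv Y ** X)" by (simp add: R det_mul mult_ac)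
  then have "ln_det ?Z = ln_det X - ln_det Y"
    using ln_det_mult[OF hpd_det_pos[OF Yi] hpd_det_pos[OF X]] ln_det_matrix_inv[OF Y]
    by (simp add: ln_det_def)
  moreover have "trace ?Z = trace (matrix_inv Y ** X)"
    using trace_mul_sym[of "mH R ** X" R] by (simp add: R matrix_mul_assoc)
  then have "trace (matrix_inv Y ** (X - Y)) = trace ?Z - CARD('n)"
    using hpd_imp_invertible[OF Y]
    by (simp add: matrix_diff_ldistrib trace_sub trace_I matrix_inv_cancel)
  ultimately show ?thesis using ln_det_le_trace[OF Z] by simp
qed

section \<open>Conditional covariance and precision\<close>

lemma psd_error_covariance:
  fixes F S R :: "complex^'n^'n"
  assumes S: "psd S" and R: "psd R" and C: "hpd (F ** S ** mH F + R)"
  defines "A \<equiv> F ** S + R"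
  shows "psd (S + R - mH A ** matrix_inv (F ** S ** mH F + R) ** A)"
proof -
  \<comment> \<open>For independent \<open>s\<close>, \<open>r\<close> with covariances \<open>S\<close>, \<open>R\<close> this is the covariance of the error in
    estimating \<open>s + r\<close> linearly from \<open>F s + r\<close>, with coefficient matrix \<open>mH Y\<close>.\<close>
  define C where "C = F ** S ** mH F + R"
  define Y where "Y = matrix_inv C ** A"
  have C_Y: "C ** Y = A"
    using C by (simp add: Y_def C_def matrix_mul_assoc matrix_inv_cancel hpd_imp_invertible)
  have mH_A: "mH A = S ** mH F + R"
    using S R by (simp add: A_def mH_add mH_mult psdD)
  let ?T = "mat 1 - mH Y ** F" and ?U = "mat 1 - mH Y"
  have "?T ** S ** mH ?T + ?U ** R ** mH ?U = S + R - mH Y ** A - mH A ** Y + mH Y ** (C ** Y)"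
    unfolding mH_A by (simp add: A_def C_def mH_diff mH_mult matrix_ring_simps)
  also have "\<dots> = S + R - mH A ** matrix_inv C ** A"
    unfolding C_Y by (simp add: Y_def matrix_mul_assoc)
  finally show ?thesis
    using psd_add[OF psd_congruence[OF S, of ?T] psd_congruence[OF R, of ?U]] by (simp add: C_def)
qed

definition resolvent :: "real \<Rightarrow> complex^'n^'n \<Rightarrow> complex^'n^'n \<Rightarrow> complex^'n^'n" where
  "resolvent c P G = matrix_inv (G ** P + c *\<^sub>R mat 1)"

text \<open>
  If \<open>G\<close> is invertible this is \<open>(P + c G\<^sup>-\<^sup>1)\<^sup>-\<^sup>1\<close>, the posterior covariance for a prior with
  covariance \<open>G / c\<close> and an observation with precision \<open>P\<close>.
\<close>

definition post_cov :: "real \<Rightarrow> complex^'n^'n \<Rightarrow> complex^'n^'n \<Rightarrow> complex^'n^'n" where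
  "post_cov c P G = resolvent c P G ** G"

lemma det_psd_mult_add_scaleR_pos:
  fixes G P :: "complex^'n^'n"
  assumes "psd G" and "psd P" and "0 < c"
  shows "0 < det (G ** P + c *\<^sub>R mat 1)"
proof -
  obtain R :: "complex^'n^'n" where R: "G = R ** mH R"
    using assms(1) by (rule psd_factorization)
  have "det (G ** P + c *\<^sub>R mat 1) = det (c *\<^sub>R mat 1 + mH R ** P ** R)"
    using det_mat_add_mult_commute[of "of_real c" R "mH R ** P"]
    by (simp add: R scaleR_mat_one add.commute matrix_mul_assoc)
  also have "\<dots> > 0"
    using assms psd_congruence[OF assms(2), of "mH R"]
    by (intro hpd_det_pos hpd_add_psd hpd_scaleR_mat_one) simp_all
  finally show ?thesis .
qed

lemma invertible_psd_mult_add_scaleR: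
  assumes "psd G" and "psd P" and "0 < c"
  shows "invertible (G ** P + c *\<^sub>R mat 1)"
  using det_psd_mult_add_scaleR_pos[OF assms] by (auto simp: invertible_det_nz)

lemma resolvent_cancel:
  assumes "psd P" and "psd G" and "0 < c"
  shows "(G ** P + c *\<^sub>R mat 1) ** resolvent c P G = mat 1"
    and "resolvent c P G ** (G ** P + c *\<^sub>R mat 1) = mat 1"
  using assms by (simp_all add: resolvent_def matrix_inv_cancel invertible_psd_mult_add_scaleR)

lemma mH_resolvent:
  assumes "psd P" and "psd G" and "0 < c"
  shows "mH (resolvent c P G) = resolvent c G P"
  using assms
  by (simp add: resolvent_def mH_matrix_inv invertible_psd_mult_add_scaleR mH_add mH_mult
      mH_scaleR psdD)

lemma post_cov_eq_mult_resolvent: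
  assumes "psd P" and "psd G" and "0 < c"
  shows "post_cov c P G = G ** resolvent c G P"
  unfolding post_cov_def resolvent_def using assms
  by (intro matrix_inv_push_through invertible_psd_mult_add_scaleR)
    (simp_all add: matrix_ring_simps)

lemma psd_post_cov:
  assumes P: "psd P" and G: "psd G" and c: "0 < c"
  shows "psd (post_cov c P G)"
proof -
  let ?U = "resolvent c P G"
  have "post_cov c P G = ?U ** G ** ((P ** G + c *\<^sub>R mat 1) ** mH ?U)"
    using assms by (simp add: mH_resolvent resolvent_cancel post_cov_def)
  also have "\<dots> = ?U ** (G ** P ** mH G + c *\<^sub>R G) ** mH ?U"
    using G by (simp add: matrix_ring_simps psdD)
  finally show ?thesis
    using assms by (simp add: psd_congruence psd_add psd_scaleR)
qed

text \<open>Operator concavity: the linear term is the derivative of \<open>post_cov c P\<close> at \<open>G\<^sub>0\<close>.\<close>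

lemma psd_post_cov_tangent_diff:
  assumes P: "psd P" and G: "psd G" and G0: "psd G\<^sub>0" and c: "0 < c"
  defines "U\<^sub>0 \<equiv> resolvent c P G\<^sub>0"
  shows "psd (post_cov c P G\<^sub>0 + c *\<^sub>R (U\<^sub>0 ** (G - G\<^sub>0) ** mH U\<^sub>0) - post_cov c P G)"
proof -
  define U X where "U = resolvent c P G" and "X = G - G\<^sub>0"
  note U = resolvent_cancel[OF P G c, folded U_def]
    and U0 = resolvent_cancel[OF P G0 c, folded U\<^sub>0_def]
  have mH_U0: "mH U\<^sub>0 = resolvent c G\<^sub>0 P"
    unfolding U\<^sub>0_def by (rule mH_resolvent[OF P G0 c])
  have mH_X: "mH X = X" using G G0 by (simp add: X_def mH_diff psdD)
  have "U\<^sub>0 - U = U\<^sub>0 ** ((G ** P + c *\<^sub>R mat 1) ** U) - (U\<^sub>0 ** (G\<^sub>0 ** P + c *\<^sub>R mat 1)) ** U"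
    by (simp add: U U0)
  also have "\<dots> = U\<^sub>0 ** X ** P ** U" by (simp add: X_def matrix_ring_simps)
  finally have U_diff: "U\<^sub>0 - U = U\<^sub>0 ** X ** P ** U" .
  have "post_cov c P G - post_cov c P G\<^sub>0
      = U ** G ** ((P ** G\<^sub>0 + c *\<^sub>R mat 1) ** mH U\<^sub>0)
        - (U ** (G ** P + c *\<^sub>R mat 1)) ** G\<^sub>0 ** mH U\<^sub>0"
    using P G0 c
    by (simp add: U mH_U0 resolvent_cancel post_cov_eq_mult_resolvent[OF P G0 c]
        post_cov_def[of c P G] flip: U_def)
  also have "\<dots> = c *\<^sub>R (U ** X ** mH U\<^sub>0)"
    by (simp add: X_def matrix_ring_simps scaleR_diff_right)
  finally have post_cov_diff: "post_cov c P G - post_cov c P G\<^sub>0 = c *\<^sub>R (U ** X ** mH U\<^sub>0)" .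
  have P_U: "P ** U = post_cov c G P"
    unfolding U_def by (rule post_cov_eq_mult_resolvent[OF G P c, symmetric])
  have "post_cov c P G\<^sub>0 + c *\<^sub>R (U\<^sub>0 ** X ** mH U\<^sub>0) - post_cov c P G
      = c *\<^sub>R (U\<^sub>0 ** X ** mH U\<^sub>0) - (post_cov c P G - post_cov c P G\<^sub>0)"
    by simp
  also have "\<dots> = c *\<^sub>R ((U\<^sub>0 - U) ** X ** mH U\<^sub>0)"
    unfolding post_cov_diff by (simp add: matrix_ring_simps scaleR_diff_right)
  also have "(U\<^sub>0 - U) ** X ** mH U\<^sub>0 = (U\<^sub>0 ** X) ** post_cov c G P ** mH (U\<^sub>0 ** X)"
    by (simp add: U_diff mH_mult mH_X P_U flip: matrix_mul_assoc)
  finally show ?thesis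
    using psd_scaleR[OF less_imp_le[OF c] psd_congruence[OF psd_post_cov[OF G P c]]]
    by (simp add: X_def)
qed

lemma trace_post_cov_le_tangent:
  assumes W: "psd W" and P: "psd P" and G: "psd G" and G0: "psd G\<^sub>0" and c: "0 < c"
  defines "U\<^sub>0 \<equiv> resolvent c P G\<^sub>0"
  shows "Re (trace (W ** (post_cov c P G - post_cov c P G\<^sub>0)))
    \<le> Re (trace (c *\<^sub>R (mH U\<^sub>0 ** W ** U\<^sub>0) ** (G - G\<^sub>0)))"
proof -
  let ?L = "c *\<^sub>R (U\<^sub>0 ** (G - G\<^sub>0) ** mH U\<^sub>0)"
  have "Re (trace (W ** (post_cov c P G - post_cov c P G\<^sub>0))) \<le> Re (trace (W ** ?L))"
    using trace_psd_mult_nonneg[OF W psd_post_cov_tangent_diff[OF P G G0 c]]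
    by (simp add: matrix_diff_ldistrib matrix_add_ldistrib trace_add trace_sub flip: U\<^sub>0_def)
  also have "W ** ?L = (c *\<^sub>R (W ** U\<^sub>0 ** (G - G\<^sub>0))) ** mH U\<^sub>0"
    by (simp add: matrix_ring_simps scaleR_diff_right)
  also have "trace \<dots> = trace (c *\<^sub>R (mH U\<^sub>0 ** W ** U\<^sub>0) ** (G - G\<^sub>0))"
    unfolding trace_mul_sym[of _ "mH U\<^sub>0"] by (simp add: matrix_ring_simps scaleR_diff_right)
  finally show ?thesis .
qed

definition cond_precision ::
  "real \<Rightarrow> complex^'m^'m \<Rightarrow> complex^'n^'m \<Rightarrow> complex^'n^'n \<Rightarrow> complex^'n^'n \<Rightarrow> complex^'m^'m" where
  "cond_precision c C A P G
    = matrix_inv C + matrix_inv C ** A ** post_cov c P G ** mH A ** matrix_inv C"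

lemma hpd_cond_precision:
  assumes "hpd C" and "psd P" and "psd G" and "0 < c"
  shows "hpd (cond_precision c C A P G)"
proof -
  have "mH (matrix_inv C) = matrix_inv C"
    using assms(1) by (intro hpdD hpd_matrix_inv)
  then show ?thesis
    using hpd_add_psd[OF hpd_matrix_inv[OF assms(1)]
        psd_congruence[OF psd_post_cov[OF assms(2-4)], of "matrix_inv C ** A"]]
    by (simp add: cond_precision_def mH_mult matrix_mul_assoc)
qed

lemma ln_det_cond_precision:
  fixes C A P G :: "complex^'n^'n"
  assumes C: "hpd C" and P: "psd P" and G: "psd G" and c: "0 < c"
  defines "Q \<equiv> P + mH A ** matrix_inv C ** A"
  shows "ln_det (cond_precision c C A P G)
    = ln_det (G ** Q + c *\<^sub>R mat 1) - ln_det (G ** P + c *\<^sub>R mat 1) - ln_det C"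
proof -
  let ?K = "cond_precision c C A P G" and ?N = "post_cov c P G" and ?MP = "G ** P + c *\<^sub>R mat 1"
  let ?E = "mH A ** matrix_inv C ** A"
  have "C ** ?K = (C ** matrix_inv C) + (C ** matrix_inv C) ** A ** ?N ** mH A ** matrix_inv C"
    by (simp add: cond_precision_def matrix_ring_simps)
  then have "C ** ?K = mat 1 + A ** (?N ** mH A ** matrix_inv C)"
    using hpd_imp_invertible[OF C] by (simp add: matrix_inv_cancel matrix_mul_assoc)
  then have "det (C ** ?K) = det (mat 1 + ?N ** ?E)"
    using det_mat_add_mult_commute[of 1 A "?N ** mH A ** matrix_inv C"]
    by (simp add: matrix_mul_assoc)
  moreover have "?MP ** (mat 1 + ?N ** ?E) = ?MP + (?MP ** resolvent c P G) ** G ** ?E"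
    by (simp add: post_cov_def matrix_add_ldistrib matrix_mul_assoc)
  then have "?MP ** (mat 1 + ?N ** ?E) = G ** Q + c *\<^sub>R mat 1"
    using P G c by (simp add: resolvent_cancel Q_def matrix_add_ldistrib)
  ultimately have "det (?MP ** (C ** ?K)) = det (G ** Q + c *\<^sub>R mat 1)"
    by (metis det_mul)
  then have "ln_det (?MP ** (C ** ?K)) = ln_det (G ** Q + c *\<^sub>R mat 1)"
    by (simp only: ln_det_def)
  moreover note K = hpd_det_pos[OF hpd_cond_precision[OF C P G c, of A]]
  have "0 < det (C ** ?K)"
    using hpd_det_pos[OF C] K by (simp add: det_mul less_le)
  ultimately show ?thesis
    using det_psd_mult_add_scaleR_pos[OF G P c] hpd_det_pos[OF C] K by (simp add: ln_det_mult)
qed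

lemma ln_det_cond_precision_le_tangent:
  fixes C :: "complex^'m^'m" and A :: "complex^'n^'m" and P G\<^sub>0 :: "complex^'n^'n"
  assumes C: "hpd C" and P: "psd P" and G0: "psd G\<^sub>0" and c: "0 < c"
  obtains T where "\<And>G. psd G \<Longrightarrow> ln_det (cond_precision c C A P G)
    \<le> ln_det (cond_precision c C A P G\<^sub>0) + Re (trace (T ** (G - G\<^sub>0)))"
proof
  define N where "N = post_cov c P"
  define K where "K = cond_precision c C A P"
  define U\<^sub>0 where "U\<^sub>0 = resolvent c P G\<^sub>0"
  define B where "B = matrix_inv C ** A"
  define W where "W = mH B ** matrix_inv (K G\<^sub>0) ** B"
  have K: "hpd (K G)" if "psd G" for G
    unfolding K_def by (rule hpd_cond_precision[OF C P that c])
  have mH_B: "mH B = mH A ** matrix_inv C"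
    using hpdD(1)[OF hpd_matrix_inv[OF C]] by (simp add: B_def mH_mult)
  have K_diff: "K G - K G\<^sub>0 = B ** (N G - N G\<^sub>0) ** mH B" for G
    unfolding mH_B
    by (simp add: K_def cond_precision_def B_def N_def matrix_ring_simps)
  have W: "psd W"
    using psd_congruence[OF hpd_imp_psd[OF hpd_matrix_inv[OF K[OF G0]]], of "mH B"]
    by (simp add: W_def)
  fix G :: "complex^'n^'n"
  assume G: "psd G"
  have "ln_det (K G) \<le> ln_det (K G\<^sub>0) + Re (trace (matrix_inv (K G\<^sub>0) ** (K G - K G\<^sub>0)))"
    by (rule ln_det_le_tangent[OF K[OF G] K[OF G0]])
  also have "trace (matrix_inv (K G\<^sub>0) ** (K G - K G\<^sub>0)) = trace (W ** (N G - N G\<^sub>0))"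
    using trace_mul_sym[of "matrix_inv (K G\<^sub>0) ** B ** (N G - N G\<^sub>0)" "mH B"]
    by (simp add: K_diff W_def matrix_mul_assoc)
  also have "Re \<dots> \<le> Re (trace (c *\<^sub>R (mH U\<^sub>0 ** W ** U\<^sub>0) ** (G - G\<^sub>0)))"
    unfolding N_def U\<^sub>0_def by (rule trace_post_cov_le_tangent[OF W P G G0 c])
  finally show "ln_det (cond_precision c C A P G) \<le> ln_det (cond_precision c C A P G\<^sub>0)
      + Re (trace (c *\<^sub>R (mH U\<^sub>0 ** W ** U\<^sub>0) ** (G - G\<^sub>0)))"
    by (simp add: K_def)
qed

lemma mult_matrix_inv_gram_eq_post_cov:
  fixes H :: "complex^'n^'m"
  assumes P: "psd P" and c: "0 < c"
  shows "mH H ** matrix_inv (H ** P ** mH H + c *\<^sub>R mat 1) ** H = post_cov c P (mH H ** H)"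
proof -
  have "matrix_inv (mH H ** H ** P + c *\<^sub>R mat 1) ** mH H
      = mH H ** matrix_inv (H ** P ** mH H + c *\<^sub>R mat 1)"
    using hpd_imp_invertible[OF hpd_add_psd[OF hpd_scaleR_mat_one[OF c] psd_congruence[OF P, of H]]]
    by (intro matrix_inv_push_through invertible_psd_mult_add_scaleR psd_gram P c)
      (simp_all add: matrix_ring_simps add.commute)
  then show ?thesis by (simp add: post_cov_def resolvent_def matrix_mul_assoc)
qed

lemma matrix_inv_cond_precision:
  fixes C :: "complex^'k^'k" and A :: "complex^'n^'k" and P :: "complex^'n^'n"
    and H :: "complex^'n^'m"
  assumes C: "hpd C" and P: "psd P" and c: "0 < c"
  defines "Q \<equiv> P + mH A ** matrix_inv C ** A"
  shows "matrix_inv (cond_precision c C A P (mH H ** H))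
    = C - A ** mH H ** matrix_inv (H ** Q ** mH H + c *\<^sub>R mat 1) ** H ** mH A"
proof -
  let ?K = "\<lambda>X. H ** X ** mH H + c *\<^sub>R mat 1"
  have K: "hpd (?K X)" if "psd X" for X
    using hpd_add_psd[OF hpd_scaleR_mat_one[OF c] psd_congruence[OF that, of H]]
    by (simp add: add.commute)
  have Q: "psd Q"
    unfolding Q_def using P psd_congruence[OF hpd_imp_psd[OF hpd_matrix_inv[OF C]], of "mH A"]
    by (simp add: psd_add)
  have KP: "?K P = ?K Q - (H ** mH A) ** matrix_inv C ** (A ** mH H)"
    by (simp add: Q_def matrix_ring_simps)
  have "cond_precision c C A P (mH H ** H)
      = matrix_inv C
        + matrix_inv C ** (A ** mH H) ** matrix_inv (?K P) ** (H ** mH A) ** matrix_inv C"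
    by (simp add: cond_precision_def matrix_mul_assoc
        flip: mult_matrix_inv_gram_eq_post_cov[OF P c])
  also have "matrix_inv \<dots> = C - (A ** mH H) ** matrix_inv (?K Q) ** (H ** mH A)"
    unfolding KP using hpd_imp_invertible[OF K[OF P], unfolded KP]
    by (intro matrix_inv_woodbury hpd_imp_invertible[OF C] hpd_imp_invertible[OF K[OF Q]])
  finally show ?thesis by (simp add: matrix_mul_assoc)
qed

section \<open>Averaging over the channel\<close>

lemma has_bochner_integral_le_eexp:
  assumes g: "has_bochner_integral M g x" and le: "\<And>w. g w \<le> f w"
  shows "ereal x \<le> eexp M f"
proof -
  let ?p = "\<integral>\<^sup>+ w. ennreal (g w) \<partial>M" and ?n = "\<integral>\<^sup>+ w. ennreal (- g w) \<partial>M"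
  have integrable: "integrable M g" using g by (simp add: has_bochner_integral_iff)
  then have fin: "?p \<noteq> \<infinity>" "?n \<noteq> \<infinity>"
    by (auto simp: real_integrable_def)
  have "ereal x = ereal (enn2real ?p) - ereal (enn2real ?n)"
    using g real_lebesgue_integral_def[OF integrable] by (simp add: has_bochner_integral_iff)
  also have "\<dots> = enn2ereal ?p - enn2ereal ?n"
    using fin by (simp add: less_top flip: enn2ereal_ennreal)
  also have "\<dots> \<le> eexp M f"
    unfolding eexp_def using le
    by (intro ereal_minus_mono iffD1[OF less_eq_ennreal.rep_eq] nn_integral_mono ennreal_leI) auto
  finally show ?thesis .
qed

lemma has_bochner_integral_trace_deviation:
  fixes G :: "'w \<Rightarrow> complex^'n^'n"
  assumes "prob_space M" and integrable_entries: "\<And>i j. integrable M (\<lambda>w. G w $ i $ j)"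
  shows "has_bochner_integral M
    (\<lambda>w. Re (trace (T ** (G w - (\<chi> i j. \<integral>w. G w $ i $ j \<partial>M))))) 0"
proof -
  interpret prob_space M by fact
  have "has_bochner_integral M (\<lambda>w. T $ i $ k * (G w $ k $ i - (\<integral>w. G w $ k $ i \<partial>M))) 0" for i k
    using integrable_entries by (simp add: has_bochner_integral_iff prob_space)
  then have "has_bochner_integral M
      (\<lambda>w. \<Sum>i\<in>UNIV. \<Sum>k\<in>UNIV. Re (T $ i $ k * (G w $ k $ i - (\<integral>w. G w $ k $ i \<partial>M))))
      (\<Sum>i::'n\<in>UNIV. \<Sum>k::'n\<in>UNIV. Re 0)"
    by (intro has_bochner_integral_sum has_bochner_integral_Re)
  then show ?thesis by (simp add: trace_def matrix_matrix_mult_def)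
qed

lemma le_eexp_if_affine_minorant:
  fixes G :: "'w \<Rightarrow> complex^'n^'n"
  assumes M: "prob_space M" and integrable_entries: "\<And>i j. integrable M (\<lambda>w. G w $ i $ j)"
    and minorant: "\<And>w. a + b * Re (trace (T ** (G w - (\<chi> i j. \<integral>w. G w $ i $ j \<partial>M)))) \<le> f w"
  shows "ereal a \<le> eexp M f"
proof -
  interpret prob_space M by fact
  note deviation = has_bochner_integral_trace_deviation[OF M integrable_entries, of T]
  have "has_bochner_integral M (\<lambda>w. a) a"
    by (simp add: has_bochner_integral_iff prob_space)
  from has_bochner_integral_add[OF this has_bochner_integral_mult_right[OF deviation, of b]]
  show ?thesis
    using has_bochner_integral_le_eexp[OF _ minorant] by simp
qed

section \<open>The rate bound\<close>

lemma psd_msum: "(\<And>t. t \<in> I \<Longrightarrow> hpd (Sig t)) \<Longrightarrow> psd (msum Sig I)"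
  by (simp add: msum_def psd_sum hpd_imp_psd)

lemma hpd_Cmat:
  assumes "psd (SigS Sig l)" and "hpd (Sig l)"
  shows "hpd (Cmat Sig F l)"
  using hpd_add_psd[OF assms(2) psd_congruence[OF assms(1), of F]]
  by (simp add: Cmat_def add.commute)

lemma psd_Dmat:
  assumes "psd (SigS Sig l)" and "hpd (Sig l)"
  shows "psd (Dmat Sig F l)"
  using psd_error_covariance[OF assms(1) hpd_imp_psd[OF assms(2)], of F] hpd_Cmat[OF assms, of F]
  by (simp add: Dmat_def Bmat_def Amat_def Cmat_def)

definition SigU_precision ::
  "(nat \<Rightarrow> complex^'n^'n) \<Rightarrow> complex^'n^'n \<Rightarrow> nat \<Rightarrow> nat \<Rightarrow> real \<Rightarrow> complex^'n^'n \<Rightarrow> complex^'n^'n" where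
  "SigU_precision Sig F L l N0
    = cond_precision N0 (Cmat Sig F l) (Amat Sig F l) (Dmat Sig F l + msum Sig {l+1..L})"

lemma logdet2_SigU:
  assumes C: "hpd (Cmat Sig F l)" and P: "psd (Dmat Sig F l + msum Sig {l+1..L})" and N0: "0 < N0"
  shows "logdet2 (SigU Sig F L l N0 H) = - ln_det (SigU_precision Sig F L l N0 (mH H ** H)) / ln 2"
proof -
  have "SigU Sig F L l N0 H = matrix_inv (SigU_precision Sig F L l N0 (mH H ** H))"
    unfolding SigU_precision_def matrix_inv_cond_precision[OF assms] SigU_def SigZ_def
    by (simp add: Dmat_def cI_def matrix_ring_simps add.assoc)
  moreover have "hpd (SigU_precision Sig F L l N0 (mH H ** H))"
    unfolding SigU_precision_def by (intro hpd_cond_precision C P psd_gram N0)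
  ultimately show ?thesis by (simp add: logdet2_eq_ln_det ln_det_matrix_inv)
qed

lemma Rupp_eq_ln_det_SigU_precision:
  assumes "hpd (Cmat Sig F l)" and "psd (Dmat Sig F l + msum Sig {l+1..L})"
    and "psd (Rg M H)" and "0 < N0"
  shows "Rupp M Sig F L l N0 H
    = logdet2 (Sig l) + ln_det (SigU_precision Sig F L l N0 (Rg M H)) / ln 2"
  unfolding SigU_precision_def ln_det_cond_precision[OF assms]
  by (simp add: Rupp_def logdet2_eq_ln_det cI_def Dmat_def algebra_simps
      flip: add_divide_distrib diff_divide_distrib)

theorem theorem2:
  fixes M :: "'w measure"
    and Sig :: "nat \<Rightarrow> complex^'nt^'nt"
    and F :: "complex^'nt^'nt"
    and H :: "'w \<Rightarrow> complex^'nt^'nr"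
    and L l :: nat and N0 :: real
  assumes "L \<ge> 1" and "N0 > 0"
    and "\<And>t. t \<in> {1..L} \<Longrightarrow> hpd (Sig t)"
    and "l \<in> {1..L}"
    and "prob_space M"
    and "H \<in> borel_measurable M"
    and "\<And>i j. integrable M (\<lambda>w. (mH (H w) ** H w) $ i $ j)"
    and "hpd (Rg M H)"
  shows "Rrate M Sig F L l N0 H \<le> ereal (Rupp M Sig F L l N0 H)"
proof -
  define K where "K = SigU_precision Sig F L l N0"
  have S: "psd (SigS Sig l)" and Sl: "hpd (Sig l)"
    using assms(3,4) by (auto simp: SigS_def intro!: psd_msum)
  note C = hpd_Cmat[OF S Sl, of F]
  have P: "psd (Dmat Sig F l + msum Sig {l+1..L})"
    using assms(3) by (intro psd_add psd_Dmat S Sl psd_msum) auto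
  have Rg: "psd (Rg M H)" by (rule hpd_imp_psd) fact
  obtain T where tangent: "\<And>G. psd G \<Longrightarrow>
      ln_det (K G) \<le> ln_det (K (Rg M H)) + Re (trace (T ** (G - Rg M H)))"
    using ln_det_cond_precision_le_tangent[OF C P Rg assms(2), of "Amat Sig F l"]
    unfolding K_def SigU_precision_def by blast
  have "- ln_det (K (Rg M H)) / ln 2 + - 1 / ln 2 * Re (trace (T ** (mH (H w) ** H w - Rg M H)))
      \<le> logdet2 (SigU Sig F L l N0 (H w))" for w
    using divide_right_mono[OF tangent[OF psd_gram, of "H w"], of "ln 2"]
    by (simp add: logdet2_SigU[OF C P assms(2)] add_divide_distrib flip: K_def)
  then have "ereal (- ln_det (K (Rg M H)) / ln 2) \<le> eexp M (\<lambda>w. logdet2 (SigU Sig F L l N0 (H w)))"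
    unfolding Rg_def by (rule le_eexp_if_affine_minorant[OF assms(5,7)])
  then have "Rrate M Sig F L l N0 H
      \<le> ereal (logdet2 (Sig l)) - ereal (- ln_det (K (Rg M H)) / ln 2)"
    unfolding Rrate_def by (intro ereal_minus_mono order.refl)
  also have "\<dots> = ereal (Rupp M Sig F L l N0 H)"
    by (simp add: Rupp_eq_ln_det_SigU_precision[OF C P Rg assms(2)] K_def)
  finally show ?thesis .
qed

end
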